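(* Let $\mathbf{G}$ be the adjacency matrix of an undirected, unweighted network without self-links on the finite node set $N$, let $i,j\in N$ be two distinct nodes, and let $T\subseteq N\setminus(N_i\cup N_j\cup\{i,j\})$. Let $\mathbf{\hat{G}}=\mathbf{G}+\sum_{k\in T}\mathbf{E}_{ik}$ and $\mathbf{\mathring{G}}=\mathbf{G}+\sum_{k\in T}\mathbf{E}_{jk}$ be the networks obtained from $\mathbf{G}$ by connecting $i$ with all nodes in $T$ and $j$ with all nodes in $T$, respectively. Suppose that in $\mathbf{G}$, $m_{ii}\gtrsim m_{jj}$ and $m_{il}\gtrsim m_{jl}$ for every $l\notin\{i,j\}$. Then $$M[[\mathcal{\hat{W}};x]]\gtrsim M[[\mathcal{\mathring{W}};x]].$$ In particular, $M[[\mathcal{\hat{W}}_{l};x]]\gtrsim M[[\mathcal{\mathring{W}}_{l};x]]$ for any $l\neq j$, and $M[[\mathcal{\hat{W}}_{i}\cup\mathcal{\hat{W}}_{j};x]]\gtrsim M[[\mathcal{\mathring{W}}_{i}\cup\mathcal{\mathring{W}}_{j};x]]$.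
   Context: $N=\{1,\dots,n\}$; $\mathbf{G}=(g_{ij})$ is symmetric with $g_{ij}\in\{0,1\}$, $g_{ii}=0$; $N_i=\{k:g_{ik}=1\}$ is the neighborhood of $i$ in $\mathbf{G}$. $\mathbf{E}_{ik}$ (for $i\ne k$) is the $n\times n$ matrix whose $(i,k)$ and $(k,i)$ entries are $1$ and all other entries are $0$. A walk in a network is a node sequence $(i_0,\dots,i_K)$, $K\ge0$, in which consecutive nodes are linked; its length is $K$ (length-zero walks are allowed). $\mathcal{\hat{W}}$ and $\mathcal{\mathring{W}}$ are the sets of all walks in $\mathbf{\hat{G}}$ and $\mathbf{\mathring{G}}$; $\mathcal{\hat{W}}_l$ and $\mathcal{\mathring{W}}_l$ are the sets of walks starting from node $l$ (with arbitrary end node) in $\mathbf{\hat{G}}$ and $\mathbf{\mathring{G}}$. For a set of walks $\mathcal{W}'$, its generating function is the formal power series $M[[\mathcal{W}';x]]=\sum_{t\ge0}c_tx^t$, where $c_t$ is the number of walks of length $t$ in $\mathcal{W}'$. $m_{kl}=M[[\mathcal{W}_{kl};x]]$, where $\mathcal{W}_{kl}$ is the set of walks from $k$ to $l$ in $\mathbf{G}$. For two such series, $\sum_t a_tx^t\gtrsim\sum_t b_tx^t$ means $a_t\ge b_t$ for all $t\ge0$. *)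

theory Defs
  imports
    "HOL-Analysis.Finite_Cartesian_Product"
    "HOL-Computational_Algebra.Formal_Power_Series"
begin

text \<open>
  The node set \<open>N = {1, ..., n}\<close> is rendered by an arbitrary finite type \<open>'n\<close>, so that
  \<open>n = CARD('n)\<close>, and networks are matrices indexed by \<open>'n\<close>.
\<close>

definition adjacency_matrix :: "real ^ 'n ^ 'n \<Rightarrow> bool" where
  "adjacency_matrix G \<longleftrightarrow>
     transpose G = G \<and> (\<forall>a b. G $ a $ b \<in> {0, 1}) \<and> (\<forall>a. G $ a $ a = 0)"

definition neighborhood :: "real ^ 'n ^ 'n \<Rightarrow> 'n \<Rightarrow> 'n set" where
  "neighborhood G a = {k. G $ a $ k = 1}"

definition link_matrix :: "'n::finite \<Rightarrow> 'n \<Rightarrow> real ^ 'n ^ 'n" where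
  "link_matrix p q =
     (\<chi> a b. if (a = p \<and> b = q) \<or> (a = q \<and> b = p) then 1 else 0)"

text \<open>
  A walk of length \<open>K\<close> is the nonempty list of its \<open>K + 1\<close> nodes.
\<close>

definition walks :: "real ^ 'n ^ 'n \<Rightarrow> 'n list set" where
  "walks G = {w. w \<noteq> [] \<and> successively (\<lambda>a b. G $ a $ b = 1) w}"

definition walks_from :: "real ^ 'n ^ 'n \<Rightarrow> 'n \<Rightarrow> 'n list set" where
  "walks_from G k = {w \<in> walks G. hd w = k}"

definition walks_between :: "real ^ 'n ^ 'n \<Rightarrow> 'n \<Rightarrow> 'n \<Rightarrow> 'n list set" where
  "walks_between G k l = {w \<in> walks G. hd w = k \<and> last w = l}"

text \<open>
  Over a finite node type only finitely many lists have a given length, so \<open>card\<close> below is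
  the true number of walks.
\<close>

definition walk_gf :: "'n::finite list set \<Rightarrow> int fps" where
  "walk_gf W = Abs_fps (\<lambda>t. int (card {w \<in> W. length w = Suc t}))"

definition fps_dominates :: "int fps \<Rightarrow> int fps \<Rightarrow> bool"  (infix \<open>\<greatersim>\<close> 50) where
  "f \<greatersim> g \<longleftrightarrow> (\<forall>t. fps_nth f t \<ge> fps_nth g t)"

end

theory Submission
  imports Defs
begin

text \<open>
  At length one, the hypothesis \<open>m\<^sub>i\<^sub>l \<greatersim> m\<^sub>j\<^sub>l\<close> says that the neighborhoods are
  nested, \<open>N\<^sub>j - {i} \<subseteq> N\<^sub>i\<close>, and the proof rests on this nesting. Write \<open>h\<^sub>t(l)\<close> and \<open>r\<^sub>t(l)\<close> for the
  numbers of walks of length \<open>t\<close> from \<open>l\<close> when \<open>T\<close> is attached to \<open>i\<close> and to \<open>j\<close>, respectively.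
  One proves \<open>h\<^sub>t(l) \<ge> r\<^sub>t(l)\<close> for \<open>l \<noteq> j\<close>, \<open>h\<^sub>t(i) + h\<^sub>t(j) \<ge> r\<^sub>t(i) + r\<^sub>t(j)\<close> and \<open>h\<^sub>t(i) \<ge> r\<^sub>t(j)\<close>
  simultaneously by induction on \<open>t\<close>. If \<open>i\<close> and \<open>j\<close> are linked, the terms \<open>h\<^sub>t(j)\<close>, \<open>r\<^sub>t(i)\<close>, \<open>r\<^sub>t(j)\<close>
  in the recursion for the claims at \<open>i\<close> cannot be compared directly; they are expanded once more,
  and the resulting sums over \<open>T\<close> and \<open>N\<^sub>i - N\<^sub>j\<close> at times \<open>t\<close> and \<open>t - 1\<close> are compared using that
  \<open>h\<^sub>t(l)\<close> is nondecreasing in \<open>t\<close> at every non-isolated node \<open>l\<close>.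
\<close>

primrec num_walks :: "('n \<Rightarrow> 'n set) \<Rightarrow> nat \<Rightarrow> 'n \<Rightarrow> nat" where
  "num_walks N 0 v = 1"
| "num_walks N (Suc t) v = (\<Sum>u\<in>N v. num_walks N t u)"

definition attach :: "('n \<Rightarrow> 'n set) \<Rightarrow> 'n \<Rightarrow> 'n set \<Rightarrow> 'n \<Rightarrow> 'n set" where
  "attach N p T v = N v \<union> (if v = p then T else {}) \<union> (if v \<in> T then {p} else {})"

text \<open>By symmetry every neighbor of \<open>v\<close> has \<open>v\<close> as a neighbor, so
  non-isolation passes to all terms of the recursion; the base case is a nonzero degree.\<close>

lemma num_walks_mono:
  fixes N :: "'n::finite \<Rightarrow> 'n set"
  assumes sym: "\<And>a b. a \<in> N b \<Longrightarrow> b \<in> N a" and "N v \<noteq> {}"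
  shows "num_walks N t v \<le> num_walks N (Suc t) v"
  using assms(2)
proof (induction t arbitrary: v)
  case 0
  then show ?case by (simp add: Suc_le_eq card_gt_0_iff)
next
  case (Suc t)
  have "num_walks N t u \<le> num_walks N (Suc t) u" if "u \<in> N v" for u
    using Suc.IH sym that by blast
  then show ?case by (auto intro: sum_mono)
qed

lemma num_walks_attach_le:
  fixes N :: "'n::finite \<Rightarrow> 'n set" and i j :: 'n and T :: "'n set"
  assumes sym: "\<And>a b. a \<in> N b \<Longrightarrow> b \<in> N a" and irrefl: "\<And>a. a \<notin> N a"
    and ij: "i \<noteq> j" and T: "T \<inter> (N i \<union> N j \<union> {i, j}) = {}"
    and nested: "N j - {i} \<subseteq> N i"
  defines "h \<equiv> num_walks (attach N i T)" and "r \<equiv> num_walks (attach N j T)"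
  shows "(\<forall>l. l \<noteq> j \<longrightarrow> r t l \<le> h t l) \<and> r t i + r t j \<le> h t i + h t j \<and> r t j \<le> h t i"
proof -
  \<comment> \<open>Given the nesting, \<open>A\<close> holds the common neighbors of
    \<open>i\<close> and \<open>j\<close>, and \<open>B\<close> those of \<open>i\<close> alone. The
    indicator \<open>g\<close> of a link between \<open>i\<close> and \<open>j\<close> lets one
    recursion serve both cases.\<close>
  define A where "A = N j - {i}"
  define B where "B = N i - N j - {j}"
  define g :: nat where "g = (if j \<in> N i then 1 else 0)"
  have Ni: "N i = (if j \<in> N i then {j} else {}) \<union> A \<union> B"
    and Nj: "N j = (if j \<in> N i then {i} else {}) \<union> A"
    using sym irrefl nested by (auto simp: A_def B_def)
  have disj: "j \<notin> A" "i \<notin> A" "j \<notin> B" "A \<inter> B = {}" "A \<inter> T = {}" "B \<inter> T = {}" "i \<notin> T" "j \<notin> T"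
    using irrefl T by (auto simp: A_def B_def)
  have sum_Ni: "sum f (N i) = g * f j + sum f A + sum f B" for f :: "'n \<Rightarrow> nat"
    by (subst Ni) (use disj in \<open>auto simp: g_def sum.union_disjoint\<close>)
  have sum_Nj: "sum f (N j) = g * f i + sum f A" for f :: "'n \<Rightarrow> nat"
    by (subst Nj) (use disj in \<open>auto simp: g_def\<close>)
  have T_N: "T \<inter> N i = {}" "T \<inter> N j = {}" using T by auto
  have h_i: "h (Suc t) i = g * h t j + sum (h t) A + sum (h t) B + sum (h t) T"
    and h_j: "h (Suc t) j = g * h t i + sum (h t) A"
    and r_i: "r (Suc t) i = g * r t j + sum (r t) A + sum (r t) B"
    and r_j: "r (Suc t) j = g * r t i + sum (r t) A + sum (r t) T" for t
    using disj ij T_N sum_Ni[of "h t"] sum_Nj[of "h t"] sum_Ni[of "r t"] sum_Nj[of "r t"]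
    by (auto simp: h_def r_def attach_def sum.union_disjoint Int_commute)
  have mono: "h t l \<le> h (Suc t) l" if "l \<in> B \<union> T" for t l
    unfolding h_def
  proof (rule num_walks_mono)
    show "a \<in> attach N i T b \<Longrightarrow> b \<in> attach N i T a" for a b
      using sym by (auto simp: attach_def split: if_splits)
    show "attach N i T l \<noteq> {}"
      using that sym by (auto simp: attach_def B_def)
  qed
  show ?thesis
  proof (induction t rule: less_induct)
    case (less t)
    show ?case
    proof (cases t)
      case 0
      then show ?thesis by (simp add: h_def r_def)
    next
      case (Suc s)
      have IH: "l \<noteq> j \<Longrightarrow> r s l \<le> h s l" "r s i + r s j \<le> h s i + h s j" "r s j \<le> h s i" for l
        using less[of s] Suc by auto
      have le_sum: "sum (r s) X \<le> sum (h s) X" if "j \<notin> X" for X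
        using that IH(1) by (metis sum_mono)
      have sums: "sum (r s) A \<le> sum (h s) A" "sum (r s) B \<le> sum (h s) B" "sum (r s) T \<le> sum (h s) T"
        using le_sum disj by auto
      have r_i_le: "r (Suc s) i \<le> h (Suc s) i" and r_j_le: "r (Suc s) j \<le> h (Suc s) i"
      proof -
        \<comment> \<open>These two bounds are what remains of the claims once \<open>sums\<close>
          has settled the like terms.\<close>
        have "g * r s j \<le> g * h s j + sum (h s) T \<and>
              g * r s i + sum (r s) A \<le> g * h s j + sum (h s) A + sum (h s) B"
        proof (cases "s = 0 \<or> g = 0")
          case True
          then show ?thesis using sums by (auto simp: h_def r_def)
        next
          case False
          then obtain q where q: "s = Suc q" and g: "g = 1"
            by (cases s) (auto simp: g_def split: if_splits)
          have IHq: "l \<noteq> j \<Longrightarrow> r q l \<le> h q l" "r q j \<le> h q i" for l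
            using less[of q] Suc q by auto
          have le_sum_q: "sum (r q) X \<le> sum (h q) X" if "j \<notin> X" for X
            using that IHq(1) by (metis sum_mono)
          have sums_q: "sum (r q) A \<le> sum (h q) A" "sum (r q) B \<le> sum (h q) B"
              "sum (r q) T \<le> sum (h q) T"
            using le_sum_q disj by auto
          \<comment> \<open>Expanding \<open>r s j\<close> leaves a sum over \<open>T\<close> at
            time \<open>q\<close>, and expanding \<open>r s i\<close> one over \<open>B\<close>;
            monotonicity lifts both to time \<open>s\<close>, where the right-hand sides offer
            them.\<close>
          have "sum (h q) B \<le> sum (h s) B" "sum (h q) T \<le> sum (h s) T"
            unfolding q using mono by (auto intro: sum_mono)
          then show ?thesis
            using sums sums_q IHq(1)[of i] IHq(2) ij h_j[of q] r_i[of q] r_j[of q]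
            by (simp add: g flip: q)
        qed
        then show "r (Suc s) i \<le> h (Suc s) i" "r (Suc s) j \<le> h (Suc s) i"
          unfolding h_i r_i r_j using sums by linarith+
      qed
      have "g * (r s i + r s j) \<le> g * (h s i + h s j)"
        using IH(2) by simp
      then have both: "r (Suc s) i + r (Suc s) j \<le> h (Suc s) i + h (Suc s) j"
        unfolding h_i h_j r_i r_j distrib_left using sums by linarith
      have "r (Suc s) l \<le> h (Suc s) l" if l: "l \<noteq> j" for l
      proof (cases "l = i")
        case True
        then show ?thesis using r_i_le by simp
      next
        case False
        have "sum (r s) (N l) \<le> sum (h s) (N l)"
        proof (cases "j \<in> N l")
          \<comment> \<open>Nesting makes \<open>i\<close> a neighbor of \<open>l\<close> too, so
            the two terms are compared as a pair.\<close>
          case True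
          then have "i \<in> N l" using nested sym False by blast
          then have split: "sum f (N l) = (f i + f j) + sum f (N l - {i, j})" for f :: "'n \<Rightarrow> nat"
            using True ij by (subst sum.subset_diff[of "{i, j}"]) auto
          show ?thesis
            unfolding split by (intro add_mono[OF IH(2) le_sum]) auto
        qed (rule le_sum)
        \<comment> \<open>A node of \<open>T\<close> gains the neighbor \<open>i\<close> in one
          network and \<open>j\<close> in the other, which is where \<open>r s j \<le> h s i\<close>
          is used.\<close>
        moreover have "l \<in> T \<Longrightarrow> i \<notin> N l \<and> j \<notin> N l" using T sym by blast
        ultimately show ?thesis
          using False l IH(3) by (auto simp: h_def r_def attach_def)
      qed
      then show ?thesis using both r_j_le Suc by blast
    qed
  qed
qed

lemma card_walks_from:
  fixes G :: "real ^ 'n ^ 'n"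
  shows "card {w \<in> walks_from G v. length w = Suc t} = num_walks (neighborhood G) t v"
proof (induction t arbitrary: v)
  case 0
  have "{w \<in> walks_from G v. length w = Suc 0} = {[v]}"
    by (auto simp: walks_from_def walks_def length_Suc_conv)
  then show ?case by simp
next
  case (Suc t)
  let ?W = "\<lambda>u. {w \<in> walks_from G u. length w = Suc t}"
  have fin: "finite (?W u)" for u
    by (rule finite_subset[OF _ finite_lists_length_eq[of UNIV "Suc t"]]) auto
  have "{w \<in> walks_from G v. length w = Suc (Suc t)} = (\<Union>u\<in>neighborhood G v. (#) v ` ?W u)"
    by (auto simp: walks_from_def walks_def neighborhood_def length_Suc_conv successively_Cons)
  also have "card \<dots> = (\<Sum>u\<in>neighborhood G v. card ((#) v ` ?W u))"
    by (rule card_UN_disjoint) (simp_all add: fin, auto simp: walks_from_def)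
  also have "\<dots> = num_walks (neighborhood G) (Suc t) v"
    by (simp add: card_image Suc.IH)
  finally show ?case .
qed

text \<open>Walks with different first nodes are distinct, so counts add up. Taking \<open>V\<close>
  as \<open>UNIV\<close>, a singleton or \<open>{i, j}\<close> yields all three conclusions.\<close>

lemma walk_gf_walks_from_nth:
  "fps_nth (walk_gf (\<Union>v\<in>V. walks_from G v)) t = int (\<Sum>v\<in>V. num_walks (neighborhood G) t v)"
proof -
  have fin: "finite {w \<in> walks_from G v. length w = Suc t}" for v
    by (rule finite_subset[OF _ finite_lists_length_eq[of UNIV "Suc t"]]) auto
  have "{w \<in> (\<Union>v\<in>V. walks_from G v). length w = Suc t} =
        (\<Union>v\<in>V. {w \<in> walks_from G v. length w = Suc t})"
    by auto
  moreover have "card \<dots> = (\<Sum>v\<in>V. card {w \<in> walks_from G v. length w = Suc t})"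
    by (rule card_UN_disjoint) (simp_all add: fin, auto simp: walks_from_def)
  ultimately show ?thesis
    by (simp add: walk_gf_def card_walks_from)
qed

lemma walk_gf_walks_between_1:
  "fps_nth (walk_gf (walks_between G a b)) (Suc 0) = (if b \<in> neighborhood G a then 1 else 0)"
proof -
  have "{w \<in> walks_between G a b. length w = Suc (Suc 0)} = (if b \<in> neighborhood G a then {[a, b]} else {})"
    by (auto simp: walks_between_def walks_def neighborhood_def length_Suc_conv)
  then show ?thesis by (simp add: walk_gf_def)
qed

text \<open>Disjointness keeps every entry at most 1, so no added link turns an entry into 2 and
  hides it from \<open>neighborhood\<close>.\<close>

lemma neighborhood_add_links:
  assumes "adjacency_matrix G" and "p \<notin> T" and "T \<inter> neighborhood G p = {}"
  shows "neighborhood (G + (\<Sum>k\<in>T. link_matrix p k)) = attach (neighborhood G) p T"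
proof -
  have sym: "G $ a $ b = G $ b $ a" for a b
    using assms(1) unfolding adjacency_matrix_def by (metis transpose_def vec_lambda_beta)
  have G01: "G $ a $ b = 0 \<or> G $ a $ b = 1" for a b
    using assms(1) by (auto simp: adjacency_matrix_def)
  \<comment> \<open>At most one \<open>k\<close> contributes to a given entry: the endpoint other
    than \<open>p\<close>.\<close>
  have "(\<Sum>k\<in>T. link_matrix p k $ a $ b) =
        (\<Sum>k\<in>T. if k = (if a = p then b else a) then if a = p \<or> b = p then 1 else 0 else 0)" for a b
    using assms(2) by (intro sum.cong) (auto simp: link_matrix_def)
  then have links: "(\<Sum>k\<in>T. link_matrix p k $ a $ b) =
      (if a = p \<and> b \<in> T \<or> b = p \<and> a \<in> T then 1 else 0)" for a b
    using assms(2) by auto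
  have "G $ p $ k = 0" if "k \<in> T" for k
    using assms(3) that G01[of p k] by (auto simp: neighborhood_def)
  moreover from this have "G $ k $ p = 0" if "k \<in> T" for k
    using that sym by metis
  ultimately show ?thesis
    using assms(2) by (intro ext set_eqI) (auto simp: neighborhood_def attach_def links)
qed

theorem proposition4:
  fixes G G_hat G_ring :: "real ^ 'n ^ 'n" and i j :: 'n and T :: "'n set"
  assumes "adjacency_matrix G"
    and "i \<noteq> j"
    and "T \<subseteq> UNIV - (neighborhood G i \<union> neighborhood G j \<union> {i, j})"
    and "G_hat = G + (\<Sum>k\<in>T. link_matrix i k)"
    and "G_ring = G + (\<Sum>k\<in>T. link_matrix j k)"
    and "walk_gf (walks_between G i i) \<greatersim> walk_gf (walks_between G j j)"
    and "\<And>l. l \<notin> {i, j} \<Longrightarrow>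
           walk_gf (walks_between G i l) \<greatersim> walk_gf (walks_between G j l)"
  shows "walk_gf (walks G_hat) \<greatersim> walk_gf (walks G_ring) \<and>
         (\<forall>l. l \<noteq> j \<longrightarrow> walk_gf (walks_from G_hat l) \<greatersim> walk_gf (walks_from G_ring l)) \<and>
         walk_gf (walks_from G_hat i \<union> walks_from G_hat j)
           \<greatersim> walk_gf (walks_from G_ring i \<union> walks_from G_ring j)"
proof -
  let ?N = "neighborhood G"
  define h where "h = num_walks (attach ?N i T)"
  define r where "r = num_walks (attach ?N j T)"
  have sym: "a \<in> ?N b \<Longrightarrow> b \<in> ?N a" for a b
    using assms(1) unfolding adjacency_matrix_def neighborhood_def
    by (metis mem_Collect_eq transpose_def vec_lambda_beta)
  have irrefl: "a \<notin> ?N a" for a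
    using assms(1) by (simp add: adjacency_matrix_def neighborhood_def)
  have nested: "?N j - {i} \<subseteq> ?N i"
  proof
    fix l assume l: "l \<in> ?N j - {i}"
    then have "l \<notin> {i, j}" using irrefl by auto
    then have "fps_nth (walk_gf (walks_between G j l)) (Suc 0) \<le>
        fps_nth (walk_gf (walks_between G i l)) (Suc 0)"
      using assms(7) by (simp add: fps_dominates_def)
    then show "l \<in> ?N i"
      using l by (simp add: walk_gf_walks_between_1 split: if_splits)
  qed
  have "T \<inter> (?N i \<union> ?N j \<union> {i, j}) = {}" using assms(3) by blast
  note le = num_walks_attach_le[OF sym irrefl assms(2) this nested, folded h_def r_def]
  have nb_hat: "neighborhood G_hat = attach ?N i T"
    and nb_ring: "neighborhood G_ring = attach ?N j T"
    unfolding assms(4,5) using assms(1,3) by (blast intro: neighborhood_add_links)+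
  have hat: "fps_nth (walk_gf (\<Union>v\<in>V. walks_from G_hat v)) t = int (sum (h t) V)"
    and ring: "fps_nth (walk_gf (\<Union>v\<in>V. walks_from G_ring v)) t = int (sum (r t) V)" for V t
    by (simp_all add: walk_gf_walks_from_nth h_def r_def nb_hat nb_ring)
  have dominates: "walk_gf (\<Union>v\<in>V. walks_from G_hat v) \<greatersim> walk_gf (\<Union>v\<in>V. walks_from G_ring v)"
    \<comment> \<open>The count at \<open>j\<close> is controlled only together with the one at
      \<open>i\<close>.\<close>
    if "j \<in> V \<Longrightarrow> i \<in> V" for V
    unfolding fps_dominates_def hat ring of_nat_le_iff
  proof
    fix t
    show "sum (r t) V \<le> sum (h t) V"
    proof (cases "j \<in> V")
      case True
      then have split: "sum f V = (f i + f j) + sum f (V - {i, j})" for f :: "'n \<Rightarrow> nat"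
        using that assms(2) by (subst sum.subset_diff[of "{i, j}"]) auto
      show ?thesis
        unfolding split using le[of t] by (intro add_mono[OF _ sum_mono]) auto
    next
      case False
      then show ?thesis using le[of t] by (intro sum_mono) auto
    qed
  qed
  have "(\<Union>v. walks_from A v) = walks A" for A :: "real ^ 'n ^ 'n"
    by (auto simp: walks_from_def)
  moreover have "walk_gf (walks_from G_hat l) \<greatersim> walk_gf (walks_from G_ring l)" if "l \<noteq> j" for l
    using that dominates[of "{l}"] by simp
  ultimately show ?thesis
    using dominates[of UNIV] dominates[of "{i, j}"] by simp
qed

end
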